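(* Let $m$ be even and let $\mathcal{A}^I=[\mathcal{A}^c-\Delta,\mathcal{A}^c+\Delta]$ be an interval tensor in $T_{m,n}$. Then the following assertions are equivalent: (a) $\mathcal{A}^I$ is positive definite; (b) $\mathcal{A}^I_s$ is positive definite; (c) $\mathcal{A}^z$ is positive definite for each $z\in Y$. Likewise, the three assertions obtained by replacing "positive definite" with "positive semi-definite" throughout (a), (b), (c) are equivalent to each other.
   Context: $T_{m,n}$ is the set of real $m$th order $n$-dimensional tensors $\mathcal{A}=(a_{i_1\cdots i_m})$, $i_j\in[n]=\{1,\dots,n\}$. For $x\in\mathbb{R}^n$, $\mathcal{A}x^m=\sum_{i_1,\dots,i_m=1}^n a_{i_1\cdots i_m}x_{i_1}\cdots x_{i_m}$. The symmetrization $\mathcal{A}_s$ of $\mathcal{A}$ has entries $(a_s)_{i_1\cdots i_m}=\frac1{m!}\sum_{\sigma\in S_m}a_{\sigma(i_1)\cdots\sigma(i_m)}$, the sum being over all permutations of the $m$ index positions. Inequalities between tensors are entrywise. For $\underline{\mathcal{A}}\le\overline{\mathcal{A}}$ in $T_{m,n}$, the interval tensor is $\mathcal{A}^I=[\underline{\mathcal{A}},\overline{\mathcal{A}}]=\{\mathcal{A}\in T_{m,n}:\underline{\mathcal{A}}\le\mathcal{A}\le\overline{\mathcal{A}}\}$. Put $\mathcal{A}^c=(a^c_{i_1\cdots i_m})=\frac{\underline{\mathcal{A}}+\overline{\mathcal{A}}}{2}$ and $\Delta=(\delta_{i_1\cdots i_m})=\frac{\overline{\mathcal{A}}-\underline{\mathcal{A}}}{2}\ge\mathcal{O}$,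 so $\mathcal{A}^I=[\mathcal{A}^c-\Delta,\mathcal{A}^c+\Delta]$. The associated symmetric interval tensor is $\mathcal{A}^I_s=[\mathcal{A}^c_s-\Delta_s,\mathcal{A}^c_s+\Delta_s]$, where $\mathcal{A}^c_s,\Delta_s$ are the symmetrizations of $\mathcal{A}^c,\Delta$. $Y=\{z\in\mathbb{R}^n: |z_j|=1,\ j=1,\dots,n\}$. For $z\in Y$, $\mathcal{A}^z=\mathcal{A}^c-\Delta\times_1T_z\times_2T_z\cdots\times_mT_z$ with $T_z=\mathrm{diag}(z)$; that is, $a^z_{i_1\cdots i_m}=a^c_{i_1\cdots i_m}-\delta_{i_1\cdots i_m}z_{i_1}z_{i_2}\cdots z_{i_m}$. A tensor $\mathcal{A}\in T_{m,n}$ ($m$ even) is positive definite (resp. positive semi-definite) if $\mathcal{A}x^m>0$ (resp. $\ge0$) for every $x\in\mathbb{R}^n\setminus\{0\}$. An interval tensor is positive (semi-)definite if every tensor in it is. *)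

theory Defs
  imports "HOL-Analysis.Analysis"
begin

text \<open>
  A real tensor of order \<open>m = CARD('m)\<close> and dimension \<open>n = CARD('n)\<close> is a vector indexed by
  multi-indices: the type \<open>'m\<close> is the set of index positions, and a multi-index
  \<open>(i\<^sub>1, \<dots>, i\<^sub>m)\<close> is a function \<open>i :: 'm \<Rightarrow> 'n\<close>.  Vector-space operations,
  the entrywise order and order intervals \<open>{L..U}\<close> are those of the library for \<open>real ^ _\<close>.
\<close>

type_synonym ('m, 'n) tensor = "real ^ ('m \<Rightarrow> 'n)"

definition tensor_form :: "('m::finite, 'n::finite) tensor \<Rightarrow> real ^ 'n \<Rightarrow> real" where
  "tensor_form A x = (\<Sum>i\<in>UNIV. A $ i * (\<Prod>k\<in>UNIV. x $ i k))"

text \<open>The permutations act on index positions: \<open>i \<circ> \<sigma>\<close> is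
  \<open>(i\<^bsub>\<sigma>(1)\<^esub>, \<dots>, i\<^bsub>\<sigma>(m)\<^esub>)\<close>.\<close>

definition symmetrization :: "('m::finite, 'n::finite) tensor \<Rightarrow> ('m, 'n) tensor" where
  "symmetrization A =
     (\<chi> i. 1 / fact CARD('m) * (\<Sum>\<sigma> | \<sigma> permutes (UNIV :: 'm set). A $ (i \<circ> \<sigma>)))"

definition tensor_center :: "('m::finite, 'n::finite) tensor \<Rightarrow> ('m, 'n) tensor \<Rightarrow> ('m, 'n) tensor"
  where "tensor_center L U = (1/2) *\<^sub>R (L + U)"

definition tensor_radius :: "('m::finite, 'n::finite) tensor \<Rightarrow> ('m, 'n) tensor \<Rightarrow> ('m, 'n) tensor"
  where "tensor_radius L U = (1/2) *\<^sub>R (U - L)"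

text \<open>Only the end points of this interval are symmetric; it contains non-symmetric tensors too.\<close>

definition symmetric_interval ::
    "('m::finite, 'n::finite) tensor \<Rightarrow> ('m, 'n) tensor \<Rightarrow> ('m, 'n) tensor set" where
  "symmetric_interval L U =
     {symmetrization (tensor_center L U) - symmetrization (tensor_radius L U) ..
      symmetrization (tensor_center L U) + symmetrization (tensor_radius L U)}"

definition sign_vectors :: "(real ^ 'n::finite) set" where
  "sign_vectors = {z. \<forall>j. \<bar>z $ j\<bar> = 1}"

text \<open>The entries of
  \<open>A\<^sup>c - \<Delta> \<times>\<^sub>1 T\<^sub>z \<dots> \<times>\<^sub>m T\<^sub>z\<close>
  with \<open>T\<^sub>z = diag(z)\<close>.\<close>

definition vertex_tensor ::
    "('m::finite, 'n::finite) tensor \<Rightarrow> ('m, 'n) tensor \<Rightarrow> real ^ 'n \<Rightarrow> ('m, 'n) tensor" where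
  "vertex_tensor L U z =
     (\<chi> i. tensor_center L U $ i - tensor_radius L U $ i * (\<Prod>k\<in>UNIV. z $ i k))"

definition pos_def :: "('m::finite, 'n::finite) tensor \<Rightarrow> bool" where
  "pos_def A \<longleftrightarrow> (\<forall>x. x \<noteq> 0 \<longrightarrow> tensor_form A x > 0)"

definition pos_semidef :: "('m::finite, 'n::finite) tensor \<Rightarrow> bool" where
  "pos_semidef A \<longleftrightarrow> (\<forall>x. x \<noteq> 0 \<longrightarrow> tensor_form A x \<ge> 0)"

definition interval_pos_def :: "('m::finite, 'n::finite) tensor set \<Rightarrow> bool" where
  "interval_pos_def S \<longleftrightarrow> (\<forall>A\<in>S. pos_def A)"

definition interval_pos_semidef :: "('m::finite, 'n::finite) tensor set \<Rightarrow> bool" where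
  "interval_pos_semidef S \<longleftrightarrow> (\<forall>A\<in>S. pos_semidef A)"

end

theory Submission
  imports Defs
begin

text \<open>
  An interval tensor with center \<open>C\<close> and radius \<open>D \<ge> 0\<close> has, at each fixed point
  \<open>x\<close>, the exact least form value \<open>C x\<^sup>m - D \<bar>x\<bar>\<^sup>m\<close>, with \<open>\<bar>x\<bar>\<close> taken
  coordinatewise.  It is a lower bound because an entry of a tensor in the interval differs from the
  center by at most the entry of \<open>D\<close>, and the monomial in \<open>x\<close> that multiplies this
  difference has as its absolute value the same monomial in \<open>\<bar>x\<bar>\<close>
  (\<open>interval_lower_bound\<close>).  It is attained at the vertex tensor whose sign vector \<open>z\<close>
  satisfies \<open>z\<^sub>j x\<^sub>j = \<bar>x\<^sub>j\<bar>\<close>, because the product of the monomials in \<open>z\<close> and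
  \<open>x\<close> is then the monomial in \<open>\<bar>x\<bar>\<close> (\<open>tensor_form_vertex_at_signs\<close>).  Since
  vertices belong to the interval, definiteness of all its tensors and definiteness of all its
  vertices both say that the lower bound function is positive (or nonnegative) away from
  \<open>0\<close> (\<open>interval_values_iff_lower_form\<close>).

  Symmetrization does not change the form of a tensor (\<open>tensor_form_symmetrization\<close>), so the
  lower bound function is the same for the symmetric interval, which therefore satisfies the same
  condition.  Strict and weak positivity differ only in the set of admitted values, \<open>{0<..}\<close>
  or \<open>{0..}\<close>; the argument uses only that this set is closed upwards, so both are treated
  at once.
\<close>

definition corner_tensor ::
    "('m::finite, 'n::finite) tensor \<Rightarrow> ('m, 'n) tensor \<Rightarrow> real ^ 'n \<Rightarrow> ('m, 'n) tensor" where
  "corner_tensor C D z = (\<chi> i. C $ i - D $ i * (\<Prod>k\<in>UNIV. z $ i k))"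

definition lower_form ::
    "('m::finite, 'n::finite) tensor \<Rightarrow> ('m, 'n) tensor \<Rightarrow> real ^ 'n \<Rightarrow> real" where
  "lower_form C D x = tensor_form C x - tensor_form D \<bar>x\<bar>"

lemma lower_form_eq_sum:
  "lower_form C D x =
     (\<Sum>i\<in>UNIV. C $ i * (\<Prod>k\<in>UNIV. x $ i k) - D $ i * \<bar>\<Prod>k\<in>UNIV. x $ i k\<bar>)"
  by (simp add: lower_form_def tensor_form_def sum_subtractf abs_prod abs_vec_def)

lemma interval_lower_bound:
  fixes A C D :: "('m::finite, 'n::finite) tensor"
  assumes "A \<in> {C - D..C + D}"
  shows "lower_form C D x \<le> tensor_form A x"
  unfolding lower_form_eq_sum tensor_form_def
proof (rule sum_mono)
  fix i :: "'m \<Rightarrow> 'n"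
  let ?p = "\<Prod>k\<in>UNIV. x $ i k"
  have "\<bar>C $ i - A $ i\<bar> \<le> D $ i"
    using assms by (simp add: less_eq_vec_def abs_le_iff algebra_simps)
  then have "\<bar>(C $ i - A $ i) * ?p\<bar> \<le> D $ i * \<bar>?p\<bar>"
    by (simp add: abs_mult mult_right_mono)
  then show "C $ i * ?p - D $ i * \<bar>?p\<bar> \<le> A $ i * ?p"
    by (simp add: algebra_simps)
qed

lemma abs_prod_sign_vector:
  assumes "z \<in> sign_vectors"
  shows "\<bar>\<Prod>k\<in>UNIV. z $ i k\<bar> = 1"
  using assms by (simp add: abs_prod sign_vectors_def)

lemma corner_tensor_in_interval:
  fixes C D :: "('m::finite, 'n::finite) tensor"
  assumes "0 \<le> D" and "z \<in> sign_vectors"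
  shows "corner_tensor C D z \<in> {C - D..C + D}"
proof -
  have "\<bar>D $ i * (\<Prod>k\<in>UNIV. z $ i k)\<bar> \<le> D $ i" for i :: "'m \<Rightarrow> 'n"
    using assms by (simp add: abs_mult abs_prod_sign_vector less_eq_vec_def)
  then have "D $ i * (\<Prod>k\<in>UNIV. z $ i k) \<le> D $ i"
    and "- (D $ i * (\<Prod>k\<in>UNIV. z $ i k)) \<le> D $ i" for i :: "'m \<Rightarrow> 'n"
    by (metis abs_le_iff)+
  then show ?thesis
    by (simp add: corner_tensor_def less_eq_vec_def minus_le_iff)
qed

text \<open>
  At zero coordinates either sign works, but \<open>sgn\<close> would give \<open>0\<close>, which is
  not allowed in a sign vector.
\<close>

definition sign_vector :: "real ^ 'n::finite \<Rightarrow> real ^ 'n" where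
  "sign_vector x = (\<chi> j. if x $ j < 0 then -1 else 1)"

lemma sign_vector_in_sign_vectors: "sign_vector x \<in> sign_vectors"
  by (simp add: sign_vector_def sign_vectors_def)

lemma tensor_form_vertex_at_signs:
  fixes C D :: "('m::finite, 'n::finite) tensor"
  shows "tensor_form (corner_tensor C D (sign_vector x)) x = lower_form C D x"
proof -
  have "sign_vector x $ j * x $ j = \<bar>x $ j\<bar>" for j
    by (simp add: sign_vector_def)
  then have "(\<Prod>k\<in>UNIV. sign_vector x $ i k) * (\<Prod>k\<in>UNIV. x $ i k) = \<bar>\<Prod>k\<in>UNIV. x $ i k\<bar>"
    for i :: "'m \<Rightarrow> 'n"
    by (simp add: abs_prod flip: prod.distrib)
  then show ?thesis
    by (simp add: lower_form_eq_sum tensor_form_def corner_tensor_def left_diff_distrib mult.assoc)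
qed

text \<open>
  An interval tensor takes values above the lower bound, hence in \<open>V\<close> if the bound is; conversely
  the bound at \<open>x\<close> is itself a value, that of the vertex at the signs of \<open>x\<close>.
\<close>

lemma interval_values_iff_lower_form:
  fixes V :: "real set"
  assumes "0 \<le> D" and up: "\<And>a b. a \<in> V \<Longrightarrow> a \<le> b \<Longrightarrow> b \<in> V"
  shows "(\<forall>A\<in>{C - D..C + D}. \<forall>x. x \<noteq> 0 \<longrightarrow> tensor_form A x \<in> V) \<longleftrightarrow>
         (\<forall>x. x \<noteq> 0 \<longrightarrow> lower_form C D x \<in> V)"
    and "(\<forall>z\<in>sign_vectors. \<forall>x. x \<noteq> 0 \<longrightarrow> tensor_form (corner_tensor C D z) x \<in> V) \<longleftrightarrow>
         (\<forall>x. x \<noteq> 0 \<longrightarrow> lower_form C D x \<in> V)"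
proof -
  have attained: "\<exists>z\<in>sign_vectors. tensor_form (corner_tensor C D z) x = lower_form C D x" for x
    using sign_vector_in_sign_vectors tensor_form_vertex_at_signs by blast
  have corner: "corner_tensor C D z \<in> {C - D..C + D}" if "z \<in> sign_vectors" for z
    using corner_tensor_in_interval[OF assms(1) that] .
  have above: "tensor_form A x \<in> V" if "A \<in> {C - D..C + D}" "lower_form C D x \<in> V" for A x
    using up[OF that(2) interval_lower_bound[OF that(1)]] .
  show "(\<forall>A\<in>{C - D..C + D}. \<forall>x. x \<noteq> 0 \<longrightarrow> tensor_form A x \<in> V) \<longleftrightarrow>
         (\<forall>x. x \<noteq> 0 \<longrightarrow> lower_form C D x \<in> V)"
    by (metis attained corner above)
  show "(\<forall>z\<in>sign_vectors. \<forall>x. x \<noteq> 0 \<longrightarrow> tensor_form (corner_tensor C D z) x \<in> V) \<longleftrightarrow>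
         (\<forall>x. x \<noteq> 0 \<longrightarrow> lower_form C D x \<in> V)"
    by (metis attained corner above)
qed

text \<open>
  Permuting the index positions of a monomial does not change it, so each of the \<open>m!\<close> summands of
  the symmetrization contributes the same form.
\<close>

lemma tensor_form_symmetrization:
  fixes A :: "('m::finite, 'n::finite) tensor"
  shows "tensor_form (symmetrization A) x = tensor_form A x"
proof -
  let ?P = "{\<sigma>. \<sigma> permutes (UNIV :: 'm set)}"
  have permuted: "(\<Sum>i\<in>UNIV. A $ (i \<circ> \<sigma>) * (\<Prod>k\<in>UNIV. x $ i k)) = tensor_form A x"
    if "\<sigma> \<in> ?P" for \<sigma>
  proof -
    have bij: "bij \<sigma>"
      using that by (simp add: permutes_bij)
    have "(\<Prod>k\<in>UNIV. x $ i k) = (\<Prod>k\<in>UNIV. x $ (i \<circ> \<sigma>) k)" for i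
      using prod.reindex_bij_betw[OF bij, of "\<lambda>k. x $ i k"] by simp
    moreover have "bij (\<lambda>i :: 'm \<Rightarrow> 'n. i \<circ> \<sigma>)"
      by (rule o_bij[where g = "\<lambda>i. i \<circ> inv \<sigma>"])
        (use bij in \<open>simp_all add: fun_eq_iff bij_is_inj bij_is_surj surj_f_inv_f\<close>)
    ultimately show ?thesis
      using sum.reindex_bij_betw[of "\<lambda>i. i \<circ> \<sigma>" UNIV UNIV
          "\<lambda>i. A $ i * (\<Prod>k\<in>UNIV. x $ i k)"]
      by (simp add: tensor_form_def)
  qed
  have "tensor_form (symmetrization A) x =
      1 / fact CARD('m) * (\<Sum>i\<in>UNIV. \<Sum>\<sigma>\<in>?P. A $ (i \<circ> \<sigma>) * (\<Prod>k\<in>UNIV. x $ i k))"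
    by (simp add: tensor_form_def symmetrization_def sum_distrib_right sum_divide_distrib)
  also have "\<dots> = 1 / fact CARD('m) * (\<Sum>\<sigma>\<in>?P. tensor_form A x)"
    by (subst sum.swap) (simp only: permuted cong: sum.cong)
  also have "\<dots> = tensor_form A x"
    by (simp add: card_permutations)
  finally show ?thesis .
qed

lemma symmetrization_nonneg:
  assumes "0 \<le> D"
  shows "0 \<le> symmetrization D"
  using assms by (simp add: symmetrization_def less_eq_vec_def sum_nonneg)

lemma lower_form_symmetrization:
  "lower_form (symmetrization C) (symmetrization D) x = lower_form C D x"
  by (simp add: lower_form_def tensor_form_symmetrization)

theorem theorem3p2:
  fixes L U :: "('m::finite, 'n::finite) tensor"
  assumes "even CARD('m)" and "L \<le> U"
  shows "(interval_pos_def {L..U} \<longleftrightarrow> interval_pos_def (symmetric_interval L U)) \<and>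
         (interval_pos_def (symmetric_interval L U) \<longleftrightarrow>
            (\<forall>z\<in>sign_vectors. pos_def (vertex_tensor L U z))) \<and>
         (interval_pos_semidef {L..U} \<longleftrightarrow> interval_pos_semidef (symmetric_interval L U)) \<and>
         (interval_pos_semidef (symmetric_interval L U) \<longleftrightarrow>
            (\<forall>z\<in>sign_vectors. pos_semidef (vertex_tensor L U z)))"
proof -
  define C where "C = tensor_center L U"
  define D where "D = tensor_radius L U"
  have D: "0 \<le> D"
    using assms(2) by (simp add: D_def tensor_radius_def less_eq_vec_def)
  have interval: "{L..U} = {C - D..C + D}"
    by (simp add: C_def D_def tensor_center_def tensor_radius_def vec_eq_iff field_simps)
  have symmetric: "symmetric_interval L U =
      {symmetrization C - symmetrization D..symmetrization C + symmetrization D}"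
    by (simp add: symmetric_interval_def C_def D_def)
  have vertex: "vertex_tensor L U z = corner_tensor C D z" for z
    by (simp add: vertex_tensor_def corner_tensor_def C_def D_def)
  note bound_iff = interval_values_iff_lower_form[OF D]
    interval_values_iff_lower_form(1)[OF symmetrization_nonneg[OF D]]
  note bound_pos = bound_iff[where V = "{0<..}"] and bound_nonneg = bound_iff[where V = "{0..}"]
  show ?thesis
    unfolding interval_pos_def_def interval_pos_semidef_def pos_def_def pos_semidef_def
      interval symmetric vertex
    using bound_pos bound_nonneg by (simp add: lower_form_symmetrization)
qed

end
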